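(* Let $\mathcal{C}$ be an additive category such that every morphism has a pseudokernel and a pseudocokernel. Let $\mathcal{B}$ be a (full) subcategory of $\mathcal{C}$. Consider the following sentences: (1) $\mathcal{B}$ is a coreflective subcategory of $\mathcal{C}$. (2) $\mathcal{B}$ is precovering, closed under taking direct summands, and every morphism in $\mathcal{B}$ has a pseudocokernel in $\mathcal{C}$ which belongs to $\mathcal{B}$. Then (1) implies (2). If $\mathcal{C}$ has split idempotents, then (2) implies (1) as well.
   Context: All subcategories are full and closed under isomorphisms. A subcategory $\mathcal{B}$ of $\mathcal{C}$ is coreflective if the inclusion functor $\mathcal{B}\to\mathcal{C}$ has a right adjoint. A pseudokernel of $f:A\to B$ is a morphism $k:K\to A$ with $fk=0$ such that every $k':K'\to A$ with $fk'=0$ factors (not necessarily uniquely) through $k$. Dually, a pseudocokernel of $f:A\to B$ is a morphism $c:B\to C$ with $cf=0$ such that every $c':B\to C'$ with $c'f=0$ factors (not necessarily uniquely) through $c$. A pseudocokernel $c:B\to C$ "belongs to $\mathcal{B}$" if $C\in\mathcal{B}$. A $\mathcal{B}$-precover of an object $A$ is a morphism $f:B\to A$ with $B\in\mathcal{B}$ such that $\mathcal{C}(B',f):\mathcal{C}(B',B)\to\mathcal{C}(B',A)$ is surjective for every $B'\in\mathcal{B}$; $\mathcal{B}$ is precovering if every object of $\mathcal{C}$ has a $\mathcal{B}$-precover. $\mathcal{C}$ has split idempotents if for every idempotent $e\in\mathcal{C}(A,A)$ there are morphisms $p:A\to B$, $i:B\to A$ with $pi=1_B$ and $ip=e$. 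*)

theory Defs
  imports "HOL-Algebra.Group"
begin

section \<open>Categories, functors, adjunctions\<close>

record ('o, 'm) cat =
  Ob :: "'o set"
  Arr :: "'m set"
  Dom :: "'m \<Rightarrow> 'o"
  Cod :: "'m \<Rightarrow> 'o"
  Ident :: "'o \<Rightarrow> 'm"
  Comp :: "'m \<Rightarrow> 'm \<Rightarrow> 'm"  (infixl "\<cdot>\<index>" 70)

text \<open>Composition is in applicative order: \<open>g \<cdot>\<^bsub>C\<^esub> f\<close> is first \<open>f\<close>, then \<open>g\<close>. Its value
  is irrelevant when \<open>Dom C g \<noteq> Cod C f\<close>.\<close>

definition Hom :: "('o, 'm, 'x) cat_scheme \<Rightarrow> 'o \<Rightarrow> 'o \<Rightarrow> 'm set" where
  "Hom C A B = {f \<in> Arr C. Dom C f = A \<and> Cod C f = B}"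

locale category =
  fixes C :: "('o, 'm, 'x) cat_scheme" (structure)
  assumes dom_in_Ob: "f \<in> Arr C \<Longrightarrow> Dom C f \<in> Ob C"
    and cod_in_Ob: "f \<in> Arr C \<Longrightarrow> Cod C f \<in> Ob C"
    and ident_in_Hom: "A \<in> Ob C \<Longrightarrow> Ident C A \<in> Hom C A A"
    and comp_in_Hom: "f \<in> Hom C A B \<Longrightarrow> g \<in> Hom C B D \<Longrightarrow> g \<cdot> f \<in> Hom C A D"
    and comp_ident_left: "f \<in> Hom C A B \<Longrightarrow> Ident C B \<cdot> f = f"
    and comp_ident_right: "f \<in> Hom C A B \<Longrightarrow> f \<cdot> Ident C A = f"
    and comp_assoc:
      "f \<in> Hom C A B \<Longrightarrow> g \<in> Hom C B D \<Longrightarrow> h \<in> Hom C D E \<Longrightarrow> (h \<cdot> g) \<cdot> f = h \<cdot> (g \<cdot> f)"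

definition isomorphic :: "('o, 'm, 'x) cat_scheme \<Rightarrow> 'o \<Rightarrow> 'o \<Rightarrow> bool" where
  "isomorphic C A B \<longleftrightarrow> (\<exists>f \<in> Hom C A B. \<exists>g \<in> Hom C B A.
     g \<cdot>\<^bsub>C\<^esub> f = Ident C A \<and> f \<cdot>\<^bsub>C\<^esub> g = Ident C B)"

record ('o, 'm, 'p, 'n) func =
  ObMap :: "'o \<Rightarrow> 'p"
  ArrMap :: "'m \<Rightarrow> 'n"

locale cat_functor = dom: category C + cod: category D
  for C :: "('o, 'm, 'x) cat_scheme" and D :: "('p, 'n, 'y) cat_scheme" +
  fixes F :: "('o, 'm, 'p, 'n) func"
  assumes ObMap_in_Ob: "A \<in> Ob C \<Longrightarrow> ObMap F A \<in> Ob D"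
    and ArrMap_in_Hom: "f \<in> Hom C A B \<Longrightarrow> ArrMap F f \<in> Hom D (ObMap F A) (ObMap F B)"
    and ArrMap_ident: "A \<in> Ob C \<Longrightarrow> ArrMap F (Ident C A) = Ident D (ObMap F A)"
    and ArrMap_comp: "f \<in> Hom C A B \<Longrightarrow> g \<in> Hom C B E \<Longrightarrow>
      ArrMap F (g \<cdot>\<^bsub>C\<^esub> f) = ArrMap F g \<cdot>\<^bsub>D\<^esub> ArrMap F f"

text \<open>\<open>right_adjoint C D F G\<close>: the functor \<open>G : D \<rightarrow> C\<close> is right adjoint to \<open>F : C \<rightarrow> D\<close>, that is,
  there are bijections \<open>D(F X, Y) \<cong> C(X, G Y)\<close> natural in \<open>X\<close> and \<open>Y\<close>.\<close>

definition right_adjoint ::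
  "('o, 'm, 'x) cat_scheme \<Rightarrow> ('p, 'n, 'y) cat_scheme \<Rightarrow>
   ('o, 'm, 'p, 'n) func \<Rightarrow> ('p, 'n, 'o, 'm) func \<Rightarrow> bool" where
  "right_adjoint C D F G \<longleftrightarrow> cat_functor C D F \<and> cat_functor D C G \<and>
     (\<exists>\<phi>. (\<forall>X \<in> Ob C. \<forall>Y \<in> Ob D.
             bij_betw (\<phi> X Y) (Hom D (ObMap F X) Y) (Hom C X (ObMap G Y))) \<and>
          (\<forall>X \<in> Ob C. \<forall>X' \<in> Ob C. \<forall>Y \<in> Ob D. \<forall>Y' \<in> Ob D.
             \<forall>h \<in> Hom C X' X. \<forall>f \<in> Hom D (ObMap F X) Y. \<forall>g \<in> Hom D Y Y'.
               \<phi> X' Y' (g \<cdot>\<^bsub>D\<^esub> (f \<cdot>\<^bsub>D\<^esub> ArrMap F h)) =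
               ArrMap G g \<cdot>\<^bsub>C\<^esub> (\<phi> X Y f \<cdot>\<^bsub>C\<^esub> h)))"


section \<open>Full subcategories\<close>

text \<open>A full subcategory closed under isomorphisms is given by its set of objects.\<close>

definition iso_closed :: "('o, 'm, 'x) cat_scheme \<Rightarrow> 'o set \<Rightarrow> bool" where
  "iso_closed C B \<longleftrightarrow> B \<subseteq> Ob C \<and> (\<forall>X \<in> B. \<forall>Y \<in> Ob C. isomorphic C X Y \<longrightarrow> Y \<in> B)"

definition full_subcat :: "('o, 'm, 'x) cat_scheme \<Rightarrow> 'o set \<Rightarrow> ('o, 'm, 'x) cat_scheme" where
  "full_subcat C B = C\<lparr>Ob := B, Arr := {f \<in> Arr C. Dom C f \<in> B \<and> Cod C f \<in> B}\<rparr>"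

definition inclusion :: "('o, 'm, 'o, 'm) func" where
  "inclusion = \<lparr>ObMap = \<lambda>A. A, ArrMap = \<lambda>f. f\<rparr>"

definition coreflective :: "('o, 'm, 'x) cat_scheme \<Rightarrow> 'o set \<Rightarrow> bool" where
  "coreflective C B \<longleftrightarrow> (\<exists>G. right_adjoint (full_subcat C B) C inclusion G)"

definition precover :: "('o, 'm, 'x) cat_scheme \<Rightarrow> 'o set \<Rightarrow> 'o \<Rightarrow> 'm \<Rightarrow> bool" where
  "precover C B A f \<longleftrightarrow> (\<exists>X \<in> B. f \<in> Hom C X A \<and>
     (\<forall>Y \<in> B. (\<lambda>g. f \<cdot>\<^bsub>C\<^esub> g) ` Hom C Y X = Hom C Y A))"

definition precovering :: "('o, 'm, 'x) cat_scheme \<Rightarrow> 'o set \<Rightarrow> bool" where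
  "precovering C B \<longleftrightarrow> (\<forall>A \<in> Ob C. \<exists>f. precover C B A f)"

definition split_idempotents :: "('o, 'm, 'x) cat_scheme \<Rightarrow> bool" where
  "split_idempotents C \<longleftrightarrow> (\<forall>A \<in> Ob C. \<forall>e \<in> Hom C A A. e \<cdot>\<^bsub>C\<^esub> e = e \<longrightarrow>
     (\<exists>B \<in> Ob C. \<exists>p \<in> Hom C A B. \<exists>i \<in> Hom C B A. p \<cdot>\<^bsub>C\<^esub> i = Ident C B \<and> i \<cdot>\<^bsub>C\<^esub> p = e))"


section \<open>Additive categories\<close>

record ('o, 'm) preadd_cat = "('o, 'm) cat" +
  HomAdd :: "'m \<Rightarrow> 'm \<Rightarrow> 'm"
  HomZero :: "'o \<Rightarrow> 'o \<Rightarrow> 'm"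

text \<open>The abelian group \<open>C(A, B)\<close>, in the multiplicative notation of HOL-Algebra.\<close>

definition Hom_group :: "('o, 'm, 'x) preadd_cat_scheme \<Rightarrow> 'o \<Rightarrow> 'o \<Rightarrow> 'm monoid" where
  "Hom_group C A B = \<lparr>carrier = Hom C A B, mult = HomAdd C, one = HomZero C A B\<rparr>"

locale preadditive_category = category C
  for C :: "('o, 'm, 'x) preadd_cat_scheme" (structure) +
  assumes Hom_comm_group: "A \<in> Ob C \<Longrightarrow> B \<in> Ob C \<Longrightarrow> comm_group (Hom_group C A B)"
    and comp_add_left: "f \<in> Hom C A B \<Longrightarrow> g \<in> Hom C B D \<Longrightarrow> g' \<in> Hom C B D \<Longrightarrow>
      HomAdd C g g' \<cdot> f = HomAdd C (g \<cdot> f) (g' \<cdot> f)"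
    and comp_add_right: "f \<in> Hom C A B \<Longrightarrow> f' \<in> Hom C A B \<Longrightarrow> g \<in> Hom C B D \<Longrightarrow>
      g \<cdot> HomAdd C f f' = HomAdd C (g \<cdot> f) (g \<cdot> f')"

definition zero_object :: "('o, 'm, 'x) cat_scheme \<Rightarrow> 'o \<Rightarrow> bool" where
  "zero_object C Z \<longleftrightarrow> Z \<in> Ob C \<and>
     (\<forall>A \<in> Ob C. (\<exists>!f. f \<in> Hom C Z A) \<and> (\<exists>!f. f \<in> Hom C A Z))"

definition is_biproduct :: "('o, 'm, 'x) preadd_cat_scheme \<Rightarrow> 'o \<Rightarrow> 'o \<Rightarrow> 'o \<Rightarrow> bool" where
  "is_biproduct C A1 A2 P \<longleftrightarrow> P \<in> Ob C \<and>
     (\<exists>i1 \<in> Hom C A1 P. \<exists>i2 \<in> Hom C A2 P. \<exists>p1 \<in> Hom C P A1. \<exists>p2 \<in> Hom C P A2.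
        p1 \<cdot>\<^bsub>C\<^esub> i1 = Ident C A1 \<and> p2 \<cdot>\<^bsub>C\<^esub> i2 = Ident C A2 \<and>
        p1 \<cdot>\<^bsub>C\<^esub> i2 = HomZero C A2 A1 \<and> p2 \<cdot>\<^bsub>C\<^esub> i1 = HomZero C A1 A2 \<and>
        HomAdd C (i1 \<cdot>\<^bsub>C\<^esub> p1) (i2 \<cdot>\<^bsub>C\<^esub> p2) = Ident C P)"

locale additive_category = preadditive_category C
  for C :: "('o, 'm, 'x) preadd_cat_scheme" (structure) +
  assumes has_zero_object: "\<exists>Z. zero_object C Z"
    and has_biproducts: "A1 \<in> Ob C \<Longrightarrow> A2 \<in> Ob C \<Longrightarrow> \<exists>P. is_biproduct C A1 A2 P"

definition direct_summand :: "('o, 'm, 'x) preadd_cat_scheme \<Rightarrow> 'o \<Rightarrow> 'o \<Rightarrow> bool" where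
  "direct_summand C A P \<longleftrightarrow> A \<in> Ob C \<and> (\<exists>A' \<in> Ob C. is_biproduct C A A' P)"

definition closed_under_summands :: "('o, 'm, 'x) preadd_cat_scheme \<Rightarrow> 'o set \<Rightarrow> bool" where
  "closed_under_summands C B \<longleftrightarrow> (\<forall>P \<in> B. \<forall>A. direct_summand C A P \<longrightarrow> A \<in> B)"

definition pseudokernel :: "('o, 'm, 'x) preadd_cat_scheme \<Rightarrow> 'm \<Rightarrow> 'm \<Rightarrow> bool" where
  "pseudokernel C f k \<longleftrightarrow> f \<in> Arr C \<and> k \<in> Arr C \<and> Cod C k = Dom C f \<and>
     f \<cdot>\<^bsub>C\<^esub> k = HomZero C (Dom C k) (Cod C f) \<and>
     (\<forall>k' \<in> Arr C. Cod C k' = Dom C f \<and> f \<cdot>\<^bsub>C\<^esub> k' = HomZero C (Dom C k') (Cod C f) \<longrightarrow>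
        (\<exists>h \<in> Hom C (Dom C k') (Dom C k). k \<cdot>\<^bsub>C\<^esub> h = k'))"

definition pseudocokernel :: "('o, 'm, 'x) preadd_cat_scheme \<Rightarrow> 'm \<Rightarrow> 'm \<Rightarrow> bool" where
  "pseudocokernel C f c \<longleftrightarrow> f \<in> Arr C \<and> c \<in> Arr C \<and> Dom C c = Cod C f \<and>
     c \<cdot>\<^bsub>C\<^esub> f = HomZero C (Dom C f) (Cod C c) \<and>
     (\<forall>c' \<in> Arr C. Dom C c' = Cod C f \<and> c' \<cdot>\<^bsub>C\<^esub> f = HomZero C (Dom C f) (Cod C c') \<longrightarrow>
        (\<exists>h \<in> Hom C (Cod C c) (Cod C c'). h \<cdot>\<^bsub>C\<^esub> c = c'))"

definition has_pseudocokernels_within :: "('o, 'm, 'x) preadd_cat_scheme \<Rightarrow> 'o set \<Rightarrow> bool" where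
  "has_pseudocokernels_within C B \<longleftrightarrow>
     (\<forall>f \<in> Arr (full_subcat C B). \<exists>c. pseudocokernel C f c \<and> Cod C c \<in> B)"

end

theory Submission
  imports Defs
begin

text \<open>A subcategory is coreflective iff every object has a universal arrow from it.
  Given such universal arrows, a morphism from an object of the subcategory lifts uniquely; lifting
  the projection of a retract inverts its universal arrow, and lifting a pseudocokernel gives a
  pseudocokernel that belongs to the subcategory.

  Conversely, let \<open>f : X \<rightarrow> A\<close> be a precover, \<open>k\<close> a pseudokernel of \<open>f\<close>, \<open>g\<close> a precover of the
  domain of \<open>k\<close>, and \<open>c : X \<rightarrow> Z\<close> a pseudocokernel of \<open>k g\<close> in the subcategory. Then \<open>f\<close> factors
  through \<open>c\<close>, and hence \<open>f = f u c\<close> for some \<open>u : Z \<rightarrow> X\<close>. So \<open>1 - u c\<close> factors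
  through \<open>k g\<close>, which gives \<open>c = c u c\<close>. The restriction of \<open>f\<close> to the image of the
  idempotent \<open>u c\<close> is the universal arrow.\<close>

section \<open>Coreflections as universal arrows\<close>

text \<open>A universal arrow from the inclusion of \<open>B\<close> to \<open>A\<close>, in other
  words the counit at \<open>A\<close> of a would-be adjunction. It strengthens
  \<open>precover\<close> from surjectivity to bijectivity, so it isolates what has to be gained
  over a precover.\<close>

definition coreflection :: "('o, 'm, 'x) cat_scheme \<Rightarrow> 'o set \<Rightarrow> 'o \<Rightarrow> 'm \<Rightarrow> bool" where
  "coreflection C B A e \<longleftrightarrow> (\<exists>X \<in> B. e \<in> Hom C X A \<and>
     (\<forall>Y \<in> B. bij_betw (\<lambda>g. e \<cdot>\<^bsub>C\<^esub> g) (Hom C Y X) (Hom C Y A)))"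

section \<open>Existence and uniqueness of factorizations\<close>

lemma coreflection_factor:
  assumes "\<forall>Y \<in> B. bij_betw (\<lambda>g. e \<cdot>\<^bsub>C\<^esub> g) (Hom C Y X) (Hom C Y A)" "Y \<in> B" "f \<in> Hom C Y A"
  obtains h where "h \<in> Hom C Y X" "e \<cdot>\<^bsub>C\<^esub> h = f"
  using assms by (metis bij_betw_imp_surj_on imageE)

lemma coreflection_unique:
  assumes "\<forall>Y \<in> B. bij_betw (\<lambda>g. e \<cdot>\<^bsub>C\<^esub> g) (Hom C Y X) (Hom C Y A)" "Y \<in> B"
    and "h \<in> Hom C Y X" "h' \<in> Hom C Y X" "e \<cdot>\<^bsub>C\<^esub> h = e \<cdot>\<^bsub>C\<^esub> h'"
  shows "h = h'"
  using assms by (metis bij_betw_imp_inj_on inj_onD)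

lemma precover_factor:
  assumes "\<forall>Y \<in> B. (\<lambda>g. e \<cdot>\<^bsub>C\<^esub> g) ` Hom C Y X = Hom C Y A" "Y \<in> B" "f \<in> Hom C Y A"
  obtains h where "h \<in> Hom C Y X" "e \<cdot>\<^bsub>C\<^esub> h = f"
  using assms by (metis imageE)

section \<open>Full subcategories and their inclusion\<close>

lemma full_subcat_simps [simp]:
  "Ob (full_subcat C B) = B"
  "Ident (full_subcat C B) = Ident C"
  "Comp (full_subcat C B) = Comp C"
  by (simp_all add: full_subcat_def)

lemma Hom_full_subcat_iff:
  "f \<in> Hom (full_subcat C B) X Y \<longleftrightarrow> f \<in> Hom C X Y \<and> X \<in> B \<and> Y \<in> B"
  by (auto simp: full_subcat_def Hom_def)

lemma Hom_full_subcat: "X \<in> B \<Longrightarrow> Y \<in> B \<Longrightarrow> Hom (full_subcat C B) X Y = Hom C X Y"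
  by (auto simp: Hom_full_subcat_iff)

lemma Arr_full_subcat_iff:
  "f \<in> Arr (full_subcat C B) \<longleftrightarrow> f \<in> Arr C \<and> Dom C f \<in> B \<and> Cod C f \<in> B"
  by (auto simp: full_subcat_def)

lemma inclusion_simps [simp]: "ObMap inclusion A = A" "ArrMap inclusion f = f"
  by (simp_all add: inclusion_def)

context category
begin

section \<open>Right adjoints of the inclusion and universal arrows\<close>

lemma Hom_obs: "f \<in> Hom C X Y \<Longrightarrow> X \<in> Ob C \<and> Y \<in> Ob C"
  using dom_in_Ob cod_in_Ob by (auto simp: Hom_def)

lemma category_full_subcat:
  assumes "B \<subseteq> Ob C"
  shows "category (full_subcat C B)"
proof
  show "Dom (full_subcat C B) f \<in> Ob (full_subcat C B)"
    "Cod (full_subcat C B) f \<in> Ob (full_subcat C B)" if "f \<in> Arr (full_subcat C B)" for f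
    using that by (auto simp: full_subcat_def)
qed (use assms ident_in_Hom in \<open>auto simp: Hom_full_subcat_iff comp_in_Hom comp_ident_left
    comp_ident_right comp_assoc\<close>)

text \<open>The universal arrow is the counit: by naturality, \<open>\<phi> Y A\<close> is inverse
  to composition with it.\<close>

lemma coreflective_imp_coreflection:
  assumes "B \<subseteq> Ob C" "coreflective C B" "A \<in> Ob C"
  shows "\<exists>e. coreflection C B A e"
proof -
  obtain G where "right_adjoint (full_subcat C B) C inclusion G"
    using assms unfolding coreflective_def by blast
  then obtain \<phi> where G: "cat_functor C (full_subcat C B) G"
    and bij: "\<And>X Y. X \<in> B \<Longrightarrow> Y \<in> Ob C \<Longrightarrow>
      bij_betw (\<phi> X Y) (Hom C X Y) (Hom (full_subcat C B) X (ObMap G Y))"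
    and nat: "\<And>X X' Y Y' h f g. \<lbrakk>X \<in> B; X' \<in> B; Y \<in> Ob C; Y' \<in> Ob C;
      h \<in> Hom (full_subcat C B) X' X; f \<in> Hom C X Y; g \<in> Hom C Y Y'\<rbrakk> \<Longrightarrow>
      \<phi> X' Y' (g \<cdot> (f \<cdot> h)) = ArrMap G g \<cdot> (\<phi> X Y f \<cdot> h)"
    unfolding right_adjoint_def full_subcat_simps inclusion_simps by blast
  interpret G: cat_functor C "full_subcat C B" G by (fact G)
  let ?X = "ObMap G A"
  have X: "?X \<in> B" using G.ObMap_in_Ob assms by simp
  have idX: "Ident C ?X \<in> Hom C ?X ?X" using X assms ident_in_Hom by auto
  \<comment> \<open>The counit is the arrow that the adjunction bijection sends to the identity of
    \<open>?X\<close>.\<close>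
  obtain e where e: "e \<in> Hom C ?X A" and \<phi>e: "\<phi> ?X A e = Ident C ?X"
    using bij_betw_imp_surj_on[OF bij[OF X assms(3)]] idX X
    by (metis (no_types, lifting) Hom_full_subcat imageE)
  have \<phi>_comp: "\<phi> Y A (e \<cdot> h) = h" if "Y \<in> B" "h \<in> Hom C Y ?X" for Y h
  proof -
    \<comment> \<open>Naturality speaks of a threefold composite, so an identity is inserted on the
      left.\<close>
    have "\<phi> Y A (e \<cdot> h) = \<phi> Y A (Ident C A \<cdot> (e \<cdot> h))"
      using comp_ident_left comp_in_Hom[OF that(2) e] by simp
    also have "\<dots> = ArrMap G (Ident C A) \<cdot> (\<phi> ?X A e \<cdot> h)"
      using that e X assms ident_in_Hom by (intro nat) (auto simp: Hom_full_subcat)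
    also have "\<dots> = Ident C ?X \<cdot> (Ident C ?X \<cdot> h)"
      using G.ArrMap_ident assms \<phi>e by simp
    finally show ?thesis using that comp_ident_left by simp
  qed
  have "bij_betw (\<lambda>g. e \<cdot> g) (Hom C Y ?X) (Hom C Y A)" if Y: "Y \<in> B" for Y
  proof (rule bij_betw_byWitness[where f' = "\<phi> Y A"])
    show "\<forall>h \<in> Hom C Y ?X. \<phi> Y A (e \<cdot> h) = h" using \<phi>_comp Y by blast
    show "(\<lambda>g. e \<cdot> g) ` Hom C Y ?X \<subseteq> Hom C Y A" using e comp_in_Hom by blast
    have b: "bij_betw (\<phi> Y A) (Hom C Y A) (Hom C Y ?X)"
      using bij[OF Y assms(3)] Hom_full_subcat[OF Y X, of C] by simp
    then show "\<phi> Y A ` Hom C Y A \<subseteq> Hom C Y ?X" by (simp add: bij_betw_def)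
    show "\<forall>f \<in> Hom C Y A. e \<cdot> \<phi> Y A f = f"
    proof
      fix f assume f: "f \<in> Hom C Y A"
      then have h: "\<phi> Y A f \<in> Hom C Y ?X" using b by (auto simp: bij_betw_def)
      \<comment> \<open>Both sides have the same image under the injective
        \<open>\<phi> Y A\<close>, by \<open>\<phi>_comp\<close> applied to
        \<open>\<phi> Y A f\<close>.\<close>
      show "e \<cdot> \<phi> Y A f = f"
        by (rule inj_onD[OF bij_betw_imp_inj_on[OF b] \<phi>_comp[OF Y h] comp_in_Hom[OF h e] f])
    qed
  qed
  then show ?thesis unfolding coreflection_def using X e by blast
qed

text \<open>Choosing a universal arrow for each object determines \<open>G\<close> on arrows.
  Functoriality and naturality follow from uniqueness: in each equation both sides are lifts of the
  same arrow.\<close>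

lemma coreflection_imp_coreflective:
  assumes B: "B \<subseteq> Ob C" and ex: "\<forall>A \<in> Ob C. \<exists>e. coreflection C B A e"
  shows "coreflective C B"
proof -
  interpret sub: category "full_subcat C B" using category_full_subcat[OF B] .
  obtain R \<epsilon> where R: "\<And>A. A \<in> Ob C \<Longrightarrow> R A \<in> B"
    and \<epsilon>: "\<And>A. A \<in> Ob C \<Longrightarrow> \<epsilon> A \<in> Hom C (R A) A"
    and bij: "\<And>A. A \<in> Ob C \<Longrightarrow>
      \<forall>Y \<in> B. bij_betw (\<lambda>g. \<epsilon> A \<cdot> g) (Hom C Y (R A)) (Hom C Y A)"
    using ex unfolding coreflection_def by metis
  \<comment> \<open>The description is meaningful only where \<open>bij\<close> gives a unique
    factor, that is, for \<open>X\<close> in \<open>B\<close>, \<open>A\<close> an object and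
    \<open>f\<close> from \<open>X\<close> to \<open>A\<close>.\<close>
  define lift where "lift X A f = (THE h. h \<in> Hom C X (R A) \<and> \<epsilon> A \<cdot> h = f)" for X A f
  have lift_eq: "lift X A f = h"
    if "X \<in> B" "A \<in> Ob C" "h \<in> Hom C X (R A)" "\<epsilon> A \<cdot> h = f" for X A f h
    unfolding lift_def
    using that coreflection_unique[OF bij[OF that(2)] that(1)] by (intro the_equality) auto
  have lift_in: "lift X A f \<in> Hom C X (R A)"
    and \<epsilon>_lift: "\<epsilon> A \<cdot> lift X A f = f"
    if "X \<in> B" "A \<in> Ob C" "f \<in> Hom C X A" for X A f
    using coreflection_factor[OF bij[OF that(2)] that(1,3)] lift_eq[OF that(1,2)] by metis+
  \<comment> \<open>\<open>ArrMap\<close> receives the bare arrow, so its ends are read off with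
    \<open>Dom\<close> and \<open>Cod\<close>. The value is the arrow that makes
    \<open>\<epsilon>\<close> natural.\<close>
  define G where "G = \<lparr>ObMap = R, ArrMap = \<lambda>f. lift (R (Dom C f)) (Cod C f) (f \<cdot> \<epsilon> (Dom C f))\<rparr>"
  have [simp]: "ObMap G = R" by (simp add: G_def)
  have Garr: "ArrMap G f = lift (R X) Y (f \<cdot> \<epsilon> X)" if "f \<in> Hom C X Y" for f X Y
    using that by (auto simp: G_def Hom_def)
  have G_in: "ArrMap G f \<in> Hom C (R X) (R Y)"
    and \<epsilon>_nat: "\<epsilon> Y \<cdot> ArrMap G f = f \<cdot> \<epsilon> X" if f: "f \<in> Hom C X Y" for f X Y
  proof -
    have o: "X \<in> Ob C" "Y \<in> Ob C" using Hom_obs f by auto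
    have "f \<cdot> \<epsilon> X \<in> Hom C (R X) Y" using comp_in_Hom[OF \<epsilon>[OF o(1)] f] .
    then show "ArrMap G f \<in> Hom C (R X) (R Y)" "\<epsilon> Y \<cdot> ArrMap G f = f \<cdot> \<epsilon> X"
      unfolding Garr[OF f] using lift_in \<epsilon>_lift R o by auto
  qed
  have "cat_functor C (full_subcat C B) G"
  proof
    show "ArrMap G f \<in> Hom (full_subcat C B) (ObMap G X) (ObMap G Y)"
      if "f \<in> Hom C X Y" for f X Y
      using that R G_in Hom_obs by (auto simp: Hom_full_subcat_iff)
    show "ArrMap G (Ident C A) = Ident (full_subcat C B) (ObMap G A)" if A: "A \<in> Ob C" for A
    proof -
      have "R A \<in> Ob C" using A R B by blast
      then show ?thesis
        unfolding Garr[OF ident_in_Hom[OF A]]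
        using A R \<epsilon>[OF A] by (auto intro!: lift_eq simp: ident_in_Hom comp_ident_left comp_ident_right)
    qed
    show "ArrMap G (g \<cdot> f) = ArrMap G g \<cdot>\<^bsub>full_subcat C B\<^esub> ArrMap G f"
      if f: "f \<in> Hom C X Y" and g: "g \<in> Hom C Y Z" for f g X Y Z
    proof -
      have o: "X \<in> Ob C" "Y \<in> Ob C" "Z \<in> Ob C" using Hom_obs f g by auto
      \<comment> \<open>The composite of the images also lifts
        \<open>(g \<cdot> f) \<cdot> \<epsilon> X\<close>, hence equals the image of the
        composite.\<close>
      have "\<epsilon> Z \<cdot> (ArrMap G g \<cdot> ArrMap G f) = (\<epsilon> Z \<cdot> ArrMap G g) \<cdot> ArrMap G f"
        using comp_assoc[OF G_in[OF f] G_in[OF g] \<epsilon>[OF o(3)]] by simp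
      also have "\<dots> = g \<cdot> (\<epsilon> Y \<cdot> ArrMap G f)"
        using comp_assoc[OF G_in[OF f] \<epsilon>[OF o(2)] g] \<epsilon>_nat[OF g] by simp
      also have "\<dots> = (g \<cdot> f) \<cdot> \<epsilon> X"
        using comp_assoc[OF \<epsilon>[OF o(1)] f g] \<epsilon>_nat[OF f] by simp
      finally show ?thesis
        unfolding Garr[OF comp_in_Hom[OF f g]]
        using lift_eq R o comp_in_Hom[OF G_in[OF f] G_in[OF g]] by simp
    qed
  qed (simp add: R)
  moreover have "cat_functor (full_subcat C B) C inclusion"
    by unfold_locales (use B in \<open>auto simp: Hom_full_subcat_iff\<close>)
  \<comment> \<open>\<open>lift\<close> serves as the adjunction bijection, with composition with
    \<open>\<epsilon> Y\<close> as its inverse.\<close>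
  moreover have "bij_betw (lift X Y) (Hom C X Y) (Hom (full_subcat C B) X (R Y))"
    if "X \<in> B" "Y \<in> Ob C" for X Y
    unfolding Hom_full_subcat[OF that(1) R[OF that(2)]]
    by (rule bij_betw_byWitness[where f' = "\<lambda>h. \<epsilon> Y \<cdot> h"])
      (use that \<epsilon> comp_in_Hom in \<open>auto simp: lift_in \<epsilon>_lift intro: lift_eq\<close>)
  moreover have "lift X' Y' (g \<cdot> (f \<cdot> h)) = ArrMap G g \<cdot> (lift X Y f \<cdot> h)"
    if X: "X \<in> B" and X': "X' \<in> B" and h: "h \<in> Hom C X' X" and f: "f \<in> Hom C X Y"
      and g: "g \<in> Hom C Y Y'" for X X' Y Y' h f g
  proof (rule lift_eq[OF X'])
    have Y: "Y \<in> Ob C" and Y': "Y' \<in> Ob C" using Hom_obs f g by auto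
    show "Y' \<in> Ob C" by fact
    note l = lift_in[OF X Y f]
    note lh = comp_in_Hom[OF h l]
    show "ArrMap G g \<cdot> (lift X Y f \<cdot> h) \<in> Hom C X' (R Y')"
      using comp_in_Hom[OF lh G_in[OF g]] .
    have "\<epsilon> Y' \<cdot> (ArrMap G g \<cdot> (lift X Y f \<cdot> h)) = (g \<cdot> \<epsilon> Y) \<cdot> (lift X Y f \<cdot> h)"
      using comp_assoc[OF lh G_in[OF g] \<epsilon>[OF Y']] \<epsilon>_nat[OF g] by simp
    also have "\<dots> = g \<cdot> ((\<epsilon> Y \<cdot> lift X Y f) \<cdot> h)"
      using comp_assoc[OF lh \<epsilon>[OF Y] g] comp_assoc[OF h l \<epsilon>[OF Y]] by simp
    finally show "\<epsilon> Y' \<cdot> (ArrMap G g \<cdot> (lift X Y f \<cdot> h)) = g \<cdot> (f \<cdot> h)"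
      using \<epsilon>_lift[OF X Y f] by simp
  qed
  ultimately have "right_adjoint (full_subcat C B) C inclusion G"
    unfolding right_adjoint_def by (auto simp: Hom_full_subcat_iff intro!: exI[of _ lift])
  then show ?thesis unfolding coreflective_def by blast
qed

text \<open>Lifting \<open>p\<close> through \<open>e\<close> gives \<open>q\<close>, and
  \<open>q \<cdot> i\<close> is a section of \<open>e\<close>. It is also a left inverse, because
  \<open>e\<close> can be cancelled on arrows from objects of \<open>B\<close>. So \<open>A\<close>
  is isomorphic to an object of \<open>B\<close>; no additive structure enters.\<close>

lemma retract_coreflection_in:
  assumes B: "iso_closed C B" and e: "coreflection C B A e"
    and P: "P \<in> B" and i: "i \<in> Hom C A P" and p: "p \<in> Hom C P A" and pi: "p \<cdot> i = Ident C A"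
  shows "A \<in> B"
proof -
  obtain X where X: "X \<in> B" and e: "e \<in> Hom C X A"
    and bij: "\<forall>Y \<in> B. bij_betw (\<lambda>g. e \<cdot> g) (Hom C Y X) (Hom C Y A)"
    using e unfolding coreflection_def by blast
  obtain q where q: "q \<in> Hom C P X" "e \<cdot> q = p" using coreflection_factor[OF bij P p] .
  have s: "q \<cdot> i \<in> Hom C A X" using comp_in_Hom[OF i q(1)] .
  have es: "e \<cdot> (q \<cdot> i) = Ident C A" using comp_assoc[OF i q(1) e] q pi by simp
  have XO: "X \<in> Ob C" using e Hom_obs by blast
  have "(q \<cdot> i) \<cdot> e = Ident C X"
  proof (rule coreflection_unique[OF bij X])
    show "(q \<cdot> i) \<cdot> e \<in> Hom C X X" using comp_in_Hom[OF e s] .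
    show "Ident C X \<in> Hom C X X" using ident_in_Hom[OF XO] .
    show "e \<cdot> ((q \<cdot> i) \<cdot> e) = e \<cdot> Ident C X"
      using comp_assoc[OF e s e] es e comp_ident_left comp_ident_right by simp
  qed
  then have "isomorphic C X A" unfolding isomorphic_def using e s es by blast
  then show ?thesis using B X Hom_obs[OF e] unfolding iso_closed_def by blast
qed

lemma coreflection_imp_precover: "coreflection C B A e \<Longrightarrow> precover C B A e"
  unfolding coreflection_def precover_def bij_betw_def by blast

end

section \<open>Preadditive categories\<close>

context preadditive_category
begin

section \<open>Zero morphisms and differences\<close>

lemma zero_in_Hom: "A \<in> Ob C \<Longrightarrow> D \<in> Ob C \<Longrightarrow> HomZero C A D \<in> Hom C A D"
  using monoid.one_closed[OF group.is_monoid[OF comm_group.axioms(2)[OF Hom_comm_group]]]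
  by (simp add: Hom_group_def)

lemma add_zero_right: "f \<in> Hom C A D \<Longrightarrow> HomAdd C f (HomZero C A D) = f"
  using monoid.r_one[OF group.is_monoid[OF comm_group.axioms(2)[OF Hom_comm_group]]] Hom_obs
  by (fastforce simp: Hom_group_def)

text \<open>Cancellation in the group of morphisms, in the form by which arrows are shown to vanish
  below.\<close>

lemma add_eq_self_imp_zero:
  assumes "f \<in> Hom C A D" "g \<in> Hom C A D" "HomAdd C f g = f"
  shows "g = HomZero C A D"
proof -
  interpret H: comm_group "Hom_group C A D" using Hom_comm_group Hom_obs assms by blast
  show ?thesis using H.r_cancel_one'[of f g] H.l_cancel_one'[of f g] assms
    by (simp add: Hom_group_def)
qed

text \<open>Stands in for subtraction: the record carries addition but no negation, so the
  difference is described by a sum.\<close>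

lemma diff_in_Hom:
  assumes "f \<in> Hom C A D" "g \<in> Hom C A D"
  obtains d where "d \<in> Hom C A D" "HomAdd C g d = f"
proof -
  interpret H: comm_group "Hom_group C A D" using Hom_comm_group Hom_obs assms by blast
  let ?d = "inv\<^bsub>Hom_group C A D\<^esub> g \<otimes>\<^bsub>Hom_group C A D\<^esub> f"
  have c: "f \<in> carrier (Hom_group C A D)" "g \<in> carrier (Hom_group C A D)"
    using assms by (simp_all add: Hom_group_def)
  have "?d \<in> carrier (Hom_group C A D)" "g \<otimes>\<^bsub>Hom_group C A D\<^esub> ?d = f"
    using c by (simp_all add: H.m_assoc[symmetric])
  then show ?thesis using that by (simp add: Hom_group_def)
qed

lemma comp_zero_right:
  assumes g: "g \<in> Hom C A D" and "X \<in> Ob C"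
  shows "g \<cdot> HomZero C X A = HomZero C X D"
proof -
  have z: "HomZero C X A \<in> Hom C X A" using assms zero_in_Hom Hom_obs by blast
  have "HomAdd C (g \<cdot> HomZero C X A) (g \<cdot> HomZero C X A) = g \<cdot> HomZero C X A"
    using comp_add_right[OF z z g] add_zero_right[OF z] by simp
  then show ?thesis using add_eq_self_imp_zero comp_in_Hom[OF z g] by blast
qed

lemma comp_zero_left:
  assumes f: "f \<in> Hom C X A" and "D \<in> Ob C"
  shows "HomZero C A D \<cdot> f = HomZero C X D"
proof -
  have z: "HomZero C A D \<in> Hom C A D" using assms zero_in_Hom Hom_obs by blast
  have "HomAdd C (HomZero C A D \<cdot> f) (HomZero C A D \<cdot> f) = HomZero C A D \<cdot> f"
    using comp_add_left[OF f z z] add_zero_right[OF z] by simp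
  then show ?thesis using add_eq_self_imp_zero comp_in_Hom[OF f z] by blast
qed

text \<open>The difference of \<open>a\<close> and \<open>a'\<close> is killed by \<open>f\<close>,
  hence zero. Only the source \<open>X\<close> is tested, since injectivity will be known only on
  arrows from objects of \<open>B\<close>.\<close>

lemma eqI_trivial_kernel:
  assumes f: "f \<in> Hom C A D" and a: "a \<in> Hom C X A" and a': "a' \<in> Hom C X A"
    and eq: "f \<cdot> a = f \<cdot> a'"
    and ker: "\<And>d. d \<in> Hom C X A \<Longrightarrow> f \<cdot> d = HomZero C X D \<Longrightarrow> d = HomZero C X A"
  shows "a = a'"
proof -
  obtain d where d: "d \<in> Hom C X A" "HomAdd C a' d = a" using diff_in_Hom[OF a a'] .
  have "HomAdd C (f \<cdot> a') (f \<cdot> d) = f \<cdot> a'"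
    using comp_add_right[OF a' d(1) f] d eq by simp
  then have "d = HomZero C X A"
    using add_eq_self_imp_zero[OF comp_in_Hom[OF a' f] comp_in_Hom[OF d(1) f]] ker d(1) by blast
  then show ?thesis using d add_zero_right[OF a'] by simp
qed

text \<open>The complement of \<open>S\<close> is the image of the idempotent
  \<open>1 - i p\<close>, which exists because idempotents split.\<close>

lemma split_idempotent_direct_summand:
  assumes split: "split_idempotents C"
    and p: "p \<in> Hom C X S" and i: "i \<in> Hom C S X" and pi: "p \<cdot> i = Ident C S"
  shows "direct_summand C S X"
proof -
  have X: "X \<in> Ob C" and S: "S \<in> Ob C" using Hom_obs p by auto
  have e: "i \<cdot> p \<in> Hom C X X" using comp_in_Hom[OF p i] .
  have pe: "p \<cdot> (i \<cdot> p) = p" using comp_assoc[OF p i p] pi comp_ident_left[OF p] by simp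
  have ei: "(i \<cdot> p) \<cdot> i = i" using comp_assoc[OF i p i] pi comp_ident_right[OF i] by simp
  note idX = ident_in_Hom[OF X]
  \<comment> \<open>Here \<open>d\<close> is the complementary idempotent
    \<open>1 - i p\<close>.\<close>
  obtain d where d: "d \<in> Hom C X X" and sum: "HomAdd C (i \<cdot> p) d = Ident C X"
    using diff_in_Hom[OF idX e] .
  have pd: "p \<cdot> d = HomZero C X S"
  proof (rule add_eq_self_imp_zero[OF p comp_in_Hom[OF d p]])
    show "HomAdd C p (p \<cdot> d) = p"
      using comp_add_right[OF e d p] sum pe comp_ident_right[OF p] by simp
  qed
  have di: "d \<cdot> i = HomZero C S X"
  proof (rule add_eq_self_imp_zero[OF i comp_in_Hom[OF i d]])
    show "HomAdd C i (d \<cdot> i) = i"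
      using comp_add_left[OF i e d] sum ei comp_ident_left[OF i] by simp
  qed
  have de: "d \<cdot> (i \<cdot> p) = HomZero C X X"
    using comp_assoc[OF p i d] di comp_zero_left[OF p X] by simp
  have dd: "d \<cdot> d = d"
  proof -
    obtain z where z: "z = HomZero C X X" "z \<in> Hom C X X" using zero_in_Hom[OF X X] by blast
    interpret H: comm_group "Hom_group C X X" using Hom_comm_group X by blast
    \<comment> \<open>Expand \<open>d \<cdot> 1\<close> with \<open>1 = i p + d\<close>; the first
      term vanishes by \<open>de\<close>.\<close>
    have "d = HomAdd C z (d \<cdot> d)"
      using comp_add_right[OF e d d] sum de z comp_ident_right[OF d] by simp
    then show ?thesis using H.l_one[of "d \<cdot> d"] comp_in_Hom[OF d d] z
      by (simp add: Hom_group_def)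
  qed
  obtain T q j where T: "T \<in> Ob C" and q: "q \<in> Hom C X T" and j: "j \<in> Hom C T X"
    and qj: "q \<cdot> j = Ident C T" and jq: "j \<cdot> q = d"
    using split d dd X unfolding split_idempotents_def by blast
  have dj: "d \<cdot> j = j" using comp_assoc[OF j q j] qj jq comp_ident_right[OF j] by simp
  have qd: "q \<cdot> d = q" using comp_assoc[OF q j q] qj jq comp_ident_left[OF q] by simp
  \<comment> \<open>The cross terms vanish because \<open>j\<close> and \<open>q\<close> absorb
    \<open>d\<close>, which is annihilated by \<open>p\<close> on the left and by \<open>i\<close>
    on the right.\<close>
  have "p \<cdot> j = HomZero C T S"
    using comp_assoc[OF j d p] dj pd comp_zero_left[OF j S] by simp
  moreover have "q \<cdot> i = HomZero C S T"
    using comp_assoc[OF i d q] qd di comp_zero_right[OF q S] by simp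
  ultimately have "is_biproduct C S T X"
    unfolding is_biproduct_def using X p i q j pi qj sum jq by blast
  then show ?thesis unfolding direct_summand_def using S T by blast
qed

text \<open>Any pseudocokernel \<open>c\<close> lifts to \<open>c'\<close> through the universal
  arrow \<open>e\<close> of its codomain. Since \<open>c\<close> factors through \<open>c'\<close>,
  so does every arrow that kills \<open>f\<close>.\<close>

lemma coreflections_imp_pseudocokernels_within:
  assumes B: "B \<subseteq> Ob C" and ex: "\<forall>A \<in> Ob C. \<exists>e. coreflection C B A e"
    and pc: "\<forall>f \<in> Arr C. \<exists>c. pseudocokernel C f c"
  shows "has_pseudocokernels_within C B"
  unfolding has_pseudocokernels_within_def
proof
  fix f assume "f \<in> Arr (full_subcat C B)"
  then obtain X Y where f: "f \<in> Hom C X Y" and X: "X \<in> B" and Y: "Y \<in> B"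
    by (auto simp: Arr_full_subcat_iff Hom_def)
  then have fD: "f \<in> Arr C" "Dom C f = X" "Cod C f = Y" by (auto simp: Hom_def)
  obtain c where c: "pseudocokernel C f c" using pc fD by blast
  define Z where "Z = Cod C c"
  have cH: "c \<in> Hom C Y Z" and cf: "c \<cdot> f = HomZero C X Z"
    using c fD by (simp_all add: pseudocokernel_def Hom_def Z_def)
  obtain e where "coreflection C B Z e" using ex Hom_obs[OF cH] by blast
  then obtain R where R: "R \<in> B" and e: "e \<in> Hom C R Z"
    and bij: "\<forall>Y \<in> B. bij_betw (\<lambda>g. e \<cdot> g) (Hom C Y R) (Hom C Y Z)"
    unfolding coreflection_def by blast
  obtain c' where c': "c' \<in> Hom C Y R" "e \<cdot> c' = c" using coreflection_factor[OF bij Y cH] .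
  have RO: "R \<in> Ob C" and XO: "X \<in> Ob C" using R X B by auto
  \<comment> \<open>Both \<open>c' \<cdot> f\<close> and zero become zero after \<open>e\<close>,
    and the source of \<open>f\<close> lies in \<open>B\<close>.\<close>
  have c'f: "c' \<cdot> f = HomZero C X R"
  proof (rule coreflection_unique[OF bij X])
    show "c' \<cdot> f \<in> Hom C X R" using comp_in_Hom[OF f c'(1)] .
    show "HomZero C X R \<in> Hom C X R" using zero_in_Hom[OF XO RO] .
    show "e \<cdot> (c' \<cdot> f) = e \<cdot> HomZero C X R"
      using comp_assoc[OF f c'(1) e] c'(2) cf comp_zero_right[OF e XO] by simp
  qed
  have c'D: "c' \<in> Arr C" "Dom C c' = Y" "Cod C c' = R" using c' by (auto simp: Hom_def)
  have "\<exists>h \<in> Hom C R (Cod C d). h \<cdot> c' = d"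
    if d: "d \<in> Arr C" "Dom C d = Y" "d \<cdot> f = HomZero C X (Cod C d)" for d
  proof -
    obtain h where h: "h \<in> Hom C Z (Cod C d)" "h \<cdot> c = d"
      using c d fD unfolding pseudocokernel_def Z_def by auto
    have "(h \<cdot> e) \<cdot> c' = d" using comp_assoc[OF c'(1) e h(1)] c' h by simp
    then show ?thesis using comp_in_Hom[OF e h(1)] by blast
  qed
  then have "pseudocokernel C f c'"
    unfolding pseudocokernel_def using fD c'D c'f by simp
  then show "\<exists>c. pseudocokernel C f c \<and> Cod C c \<in> B" using c'D R by blast
qed

text \<open>Passing to \<open>f \<cdot> i\<close> keeps surjectivity because
  \<open>f u c = f\<close>. It gains injectivity because \<open>c\<close> kills whatever
  \<open>f\<close> kills on arrows from \<open>B\<close>, so the idempotent \<open>u c\<close> does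
  too.\<close>

lemma precovering_imp_coreflection:
  assumes split: "split_idempotents C" and B: "B \<subseteq> Ob C"
    and pk: "\<forall>f \<in> Arr C. \<exists>k. pseudokernel C f k"
    and pre: "precovering C B" and summands: "closed_under_summands C B"
    and within: "has_pseudocokernels_within C B" and A: "A \<in> Ob C"
  shows "\<exists>e. coreflection C B A e"
proof -
  obtain f X where X: "X \<in> B" and f: "f \<in> Hom C X A"
    and fpre: "\<forall>Y \<in> B. (\<lambda>g. f \<cdot> g) ` Hom C Y X = Hom C Y A"
    using pre A unfolding precovering_def precover_def by blast
  have XO: "X \<in> Ob C" using X B by blast
  have fD: "f \<in> Arr C" "Dom C f = X" "Cod C f = A" using f by (auto simp: Hom_def)
  obtain k where k: "pseudokernel C f k" using pk fD by blast
  define K where "K = Dom C k"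
  have kH: "k \<in> Hom C K X" and fk: "f \<cdot> k = HomZero C K A"
    using k fD by (simp_all add: pseudokernel_def Hom_def K_def)
  obtain g Y where Y: "Y \<in> B" and g: "g \<in> Hom C Y K"
    and gpre: "\<forall>W \<in> B. (\<lambda>h. g \<cdot> h) ` Hom C W Y = Hom C W K"
    using pre Hom_obs[OF kH] unfolding precovering_def precover_def by blast
  have YO: "Y \<in> Ob C" using Y B by blast
  have kg: "k \<cdot> g \<in> Hom C Y X" using comp_in_Hom[OF g kH] .
  then have kgD: "k \<cdot> g \<in> Arr C" "Dom C (k \<cdot> g) = Y" "Cod C (k \<cdot> g) = X"
    by (auto simp: Hom_def)
  have "k \<cdot> g \<in> Arr (full_subcat C B)" using kgD X Y by (simp add: Arr_full_subcat_iff)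
  then obtain c where c: "pseudocokernel C (k \<cdot> g) c" and Z: "Cod C c \<in> B"
    using within unfolding has_pseudocokernels_within_def by blast
  define Z where "Z = Cod C c"
  have ZB: "Z \<in> B" using Z by (simp add: Z_def)
  have ZO: "Z \<in> Ob C" using ZB B by blast
  have cH: "c \<in> Hom C X Z" and ckg: "c \<cdot> (k \<cdot> g) = HomZero C Y Z"
    using c kgD by (simp_all add: pseudocokernel_def Hom_def Z_def)
  \<comment> \<open>On arrows from objects of \<open>B\<close>, \<open>k \<cdot> g\<close> is as
    good as the pseudokernel \<open>k\<close>, and its domain lies in \<open>B\<close>.\<close>
  have ker: "\<exists>t \<in> Hom C W Y. (k \<cdot> g) \<cdot> t = d"
    if W: "W \<in> B" and d: "d \<in> Hom C W X" and fd: "f \<cdot> d = HomZero C W A" for W d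
  proof -
    have "d \<in> Arr C" "Cod C d = X" "Dom C d = W" using d by (auto simp: Hom_def)
    then obtain h where h: "h \<in> Hom C W K" "k \<cdot> h = d"
      using k fD fd unfolding pseudokernel_def K_def by metis
    obtain t where t: "t \<in> Hom C W Y" "g \<cdot> t = h" using precover_factor[OF gpre W h(1)] .
    then show ?thesis using comp_assoc[OF t(1) g kH] h by auto
  qed
  have cker: "c \<cdot> d = HomZero C W Z"
    if W: "W \<in> B" and d: "d \<in> Hom C W X" and fd: "f \<cdot> d = HomZero C W A" for W d
  proof -
    obtain t where t: "t \<in> Hom C W Y" "(k \<cdot> g) \<cdot> t = d" using ker[OF W d fd] by blast
    then show ?thesis
      using comp_assoc[OF t(1) kg cH] ckg comp_zero_left[OF t(1) ZO] by simp
  qed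
  \<comment> \<open>This makes \<open>f\<close> a test arrow for \<open>c\<close>. Its codomain
    \<open>A\<close> may lie outside \<open>B\<close>, so it matters that \<open>c\<close> is a
    pseudocokernel in all of \<open>C\<close>.\<close>
  have "f \<cdot> (k \<cdot> g) = HomZero C Y A"
    using comp_assoc[OF g kH f] fk comp_zero_left[OF g A] by simp
  then obtain f' where f': "f' \<in> Hom C Z A" "f' \<cdot> c = f"
    using c fD kgD unfolding pseudocokernel_def Z_def by metis
  \<comment> \<open>The precover property applies to \<open>f'\<close> because the domain
    \<open>Z\<close> was arranged to lie in \<open>B\<close>.\<close>
  obtain u where u: "u \<in> Hom C Z X" "f \<cdot> u = f'" using precover_factor[OF fpre ZB f'(1)] .
  have e: "u \<cdot> c \<in> Hom C X X" using comp_in_Hom[OF cH u(1)] .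
  have fe: "f \<cdot> (u \<cdot> c) = f" using comp_assoc[OF cH u(1) f] u f' by simp
  \<comment> \<open>\<open>d\<close> is \<open>1 - u c\<close>; \<open>f\<close> kills it, hence so
    does \<open>c\<close>.\<close>
  obtain d where d: "d \<in> Hom C X X" and sum: "HomAdd C (u \<cdot> c) d = Ident C X"
    using diff_in_Hom[OF ident_in_Hom[OF XO] e] .
  have "HomAdd C f (f \<cdot> d) = f"
    using comp_add_right[OF e d f] fe sum comp_ident_right[OF f] by simp
  then have "f \<cdot> d = HomZero C X A" using add_eq_self_imp_zero[OF f comp_in_Hom[OF d f]] by simp
  then have cd: "c \<cdot> d = HomZero C X Z" using cker[OF X d] by simp
  have cuc: "c \<cdot> (u \<cdot> c) = c"
    using comp_add_right[OF e d cH] sum cd comp_ident_right[OF cH]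
      add_zero_right[OF comp_in_Hom[OF e cH]] by simp
  have "(u \<cdot> c) \<cdot> (u \<cdot> c) = u \<cdot> c" using comp_assoc[OF e cH u(1)] cuc by simp
  then obtain S p i where p: "p \<in> Hom C X S" and i: "i \<in> Hom C S X"
    and pi: "p \<cdot> i = Ident C S" and ip: "i \<cdot> p = u \<cdot> c"
    using split XO e unfolding split_idempotents_def by blast
  have S: "S \<in> B"
    using split_idempotent_direct_summand[OF split p i pi] summands X
    unfolding closed_under_summands_def by blast
  have fi: "f \<cdot> i \<in> Hom C S A" using comp_in_Hom[OF i f] .
  have "bij_betw (\<lambda>g. (f \<cdot> i) \<cdot> g) (Hom C W S) (Hom C W A)" if W: "W \<in> B" for W
  proof (rule bij_betw_imageI)
    show "inj_on (\<lambda>g. (f \<cdot> i) \<cdot> g) (Hom C W S)"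
    proof (rule inj_onI)
      fix a a' assume a: "a \<in> Hom C W S" "a' \<in> Hom C W S" "(f \<cdot> i) \<cdot> a = (f \<cdot> i) \<cdot> a'"
      show "a = a'"
      proof (rule eqI_trivial_kernel[OF fi a])
        fix b assume b: "b \<in> Hom C W S" "(f \<cdot> i) \<cdot> b = HomZero C W A"
        have ib: "i \<cdot> b \<in> Hom C W X" using comp_in_Hom[OF b(1) i] .
        have "f \<cdot> (i \<cdot> b) = HomZero C W A" using comp_assoc[OF b(1) i f] b by simp
        then have "c \<cdot> (i \<cdot> b) = HomZero C W Z" using cker[OF W ib] by simp
        then have "(u \<cdot> c) \<cdot> (i \<cdot> b) = HomZero C W X"
          using comp_assoc[OF ib cH u(1)] comp_zero_right[OF u(1)] W B by auto
        then have "p \<cdot> ((i \<cdot> p) \<cdot> (i \<cdot> b)) = HomZero C W S"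
          using ip comp_zero_right[OF p] W B by auto
        moreover have "p \<cdot> (i \<cdot> b) = b"
          using comp_assoc[OF b(1) i p] pi comp_ident_left[OF b(1)] by simp
        moreover from this have "(i \<cdot> p) \<cdot> (i \<cdot> b) = i \<cdot> b"
          using comp_assoc[OF ib p i] by simp
        ultimately show "b = HomZero C W S" by simp
      qed
    qed
    show "(\<lambda>g. (f \<cdot> i) \<cdot> g) ` Hom C W S = Hom C W A"
    proof (intro equalityI subsetI)
      fix w assume "w \<in> (\<lambda>g. (f \<cdot> i) \<cdot> g) ` Hom C W S"
      then show "w \<in> Hom C W A" using comp_in_Hom fi by blast
    next
      fix w assume w: "w \<in> Hom C W A"
      obtain v where v: "v \<in> Hom C W X" "f \<cdot> v = w" using precover_factor[OF fpre W w] .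
      have pv: "p \<cdot> v \<in> Hom C W S" using comp_in_Hom[OF v(1) p] .
      \<comment> \<open>Projecting a lift \<open>v\<close> through the precover to \<open>S\<close>
        loses nothing, since \<open>f\<close> absorbs \<open>i p = u c\<close>.\<close>
      have "(f \<cdot> i) \<cdot> (p \<cdot> v) = f \<cdot> ((u \<cdot> c) \<cdot> v)"
        using comp_assoc[OF pv i f] comp_assoc[OF v(1) p i] ip by simp
      also have "\<dots> = w" using comp_assoc[OF v(1) e f] fe v by simp
      finally show "w \<in> (\<lambda>g. (f \<cdot> i) \<cdot> g) ` Hom C W S" using pv by blast
    qed
  qed
  then show ?thesis unfolding coreflection_def using S fi by blast
qed

end

theorem theorem3p1:
  fixes C :: "('o, 'm, 'x) preadd_cat_scheme" and B :: "'o set"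
  assumes "additive_category C"
    and "\<forall>f \<in> Arr C. \<exists>k. pseudokernel C f k"
    and "\<forall>f \<in> Arr C. \<exists>c. pseudocokernel C f c"
    and "iso_closed C B"
  shows "(coreflective C B \<longrightarrow>
            precovering C B \<and> closed_under_summands C B \<and> has_pseudocokernels_within C B) \<and>
         (split_idempotents C \<longrightarrow>
            precovering C B \<and> closed_under_summands C B \<and> has_pseudocokernels_within C B \<longrightarrow>
            coreflective C B)"
proof (intro conjI impI)
  interpret additive_category C by fact
  have B: "B \<subseteq> Ob C" using assms(4) by (simp add: iso_closed_def)
  {
    assume "coreflective C B"
    then have ex: "\<forall>A \<in> Ob C. \<exists>e. coreflection C B A e"
      using coreflective_imp_coreflection[OF B] by blast
    show "precovering C B"
      unfolding precovering_def using ex coreflection_imp_precover by blast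
    show "closed_under_summands C B"
      unfolding closed_under_summands_def direct_summand_def is_biproduct_def
      \<comment> \<open>The first injection and projection of a biproduct exhibit the summand as a
        retract.\<close>
      using ex retract_coreflection_in[OF assms(4)] by blast
    show "has_pseudocokernels_within C B"
      using coreflections_imp_pseudocokernels_within[OF B ex assms(3)] .
  next
    assume "split_idempotents C"
      and "precovering C B \<and> closed_under_summands C B \<and> has_pseudocokernels_within C B"
    then show "coreflective C B"
      using coreflection_imp_coreflective[OF B] precovering_imp_coreflection[OF _ B assms(2)]
      by blast
  }
qed

end
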